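(* Let $p$ be a prime number and let $R$ be a non-commutative ring with unity of order $p^3$. Then $|\operatorname{Cent}(R)| = p + 2$.
   Context: Rings are associative. For $r \in R$, the centralizer of $r$ is the subring $C(r) = \{s \in R : rs = sr\}$, and $\operatorname{Cent}(R) = \{C(r) : r \in R\}$ is the set of all distinct centralizers. *)

theory Defs
  imports "HOL-Algebra.Subrings" "HOL-Computational_Algebra.Primes"
begin

definition ring_centralizer :: "('a, 'b) ring_scheme \<Rightarrow> 'a \<Rightarrow> 'a set"
  where "ring_centralizer R r = {s \<in> carrier R. r \<otimes>\<^bsub>R\<^esub> s = s \<otimes>\<^bsub>R\<^esub> r}"

definition Cent :: "('a, 'b) ring_scheme \<Rightarrow> 'a set set"
  where "Cent R = {ring_centralizer R r | r. r \<in> carrier R}"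

lemma (in ring) ring_centralizer_subring:
  assumes "r \<in> carrier R"
  shows "subring (ring_centralizer R r) R"
proof (rule subringI)
  fix h assume "h \<in> ring_centralizer R r"
  with assms show "\<ominus> h \<in> ring_centralizer R r"
    by (simp add: ring_centralizer_def l_minus r_minus)
next
  fix h k assume h: "h \<in> ring_centralizer R r" and k: "k \<in> ring_centralizer R r"
  with assms show "h \<oplus> k \<in> ring_centralizer R r"
    by (simp add: ring_centralizer_def l_distr r_distr)
  from assms h k have "r \<otimes> (h \<otimes> k) = (h \<otimes> r) \<otimes> k"
    by (simp add: ring_centralizer_def flip: m_assoc)
  also from assms h k have "\<dots> = (h \<otimes> k) \<otimes> r"
    by (simp add: ring_centralizer_def m_assoc)
  finally show "h \<otimes> k \<in> ring_centralizer R r"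
    using h k by (simp add: ring_centralizer_def)
qed (use assms in \<open>auto simp: ring_centralizer_def\<close>)

end

theory Submission
  imports Defs
begin

text \<open>
  The additive group of \<open>R\<close> has order \<open>p\<^sup>3\<close>, so no strictly increasing chain of additive
  subgroups has more than three steps. For a noncentral \<open>r\<close>, the chain
  \<open>{\<zero>} \<subset> Z \<subset> C(r) \<subset> R\<close>, with \<open>Z\<close> the centre, already has three: unity makes the first inclusion
  strict, \<open>r\<close> itself the second, and noncentrality the third. As nothing fits in between, \<open>Z\<close> has
  order \<open>p\<close> and \<open>C(r)\<close> has order \<open>p\<^sup>2\<close>.

  If \<open>x\<close> is a noncentral element of both \<open>C(r)\<close> and \<open>C(s)\<close>, then \<open>C(r) \<inter> C(x)\<close> lies
  strictly above \<open>Z\<close> because it contains \<open>x\<close>; again nothing fits between \<open>Z\<close> and \<open>C(r)\<close> or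
  between \<open>Z\<close> and \<open>C(x)\<close>, so \<open>C(r) = C(x)\<close>, and likewise \<open>C(s) = C(x)\<close>. The proper centralizers
  therefore partition the \<open>p\<^sup>3 - p\<close> noncentral elements into classes of size \<open>p\<^sup>2 - p\<close>. That gives
  \<open>p + 1\<close> of them, and \<open>R\<close>, the centralizer of \<open>\<zero>\<close>, is one more.
\<close>

text \<open>
  By Lagrange's theorem the order of every subgroup is again a power of \<open>p\<close>. Passing to its
  exponent, the height, turns statements about chains of subgroups into inequalities between
  small natural numbers.
\<close>

lemma (in group) obtain_subgroup_height:
  assumes "Factorial_Ring.prime (p :: nat)" and "order G = p ^ n"
  obtains h :: "'a set \<Rightarrow> nat" where
    "\<And>H. subgroup H G \<Longrightarrow> card H = p ^ h H"
    "\<And>H K. \<lbrakk>subgroup H G; subgroup K G; H \<subset> K\<rbrakk> \<Longrightarrow> h H < h K"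
proof -
  have fin: "finite (carrier G)"
    using assms order_gt_0_iff_finite prime_gt_0_nat by fastforce
  have "\<exists>i. card H = p ^ i" if "subgroup H G" for H
    using lagrange[OF that] assms divides_primepow_nat[OF assms(1)]
    by (metis dvd_triv_right)
  then obtain h where h: "\<And>H. subgroup H G \<Longrightarrow> card H = p ^ h H"
    by metis
  show thesis
  proof (rule that[OF h])
    fix H K assume HK: "subgroup H G" "subgroup K G" "H \<subset> K"
    then have "card H < card K"
      using fin by (meson finite_subset psubset_card_mono subgroup.subset)
    then show "h H < h K"
      using h HK prime_gt_1_nat[OF assms(1)] by simp
  qed
qed

definition ring_center :: "('a, 'b) ring_scheme \<Rightarrow> 'a set"
  where "ring_center R = \<Inter> (Cent R)"

lemma (in ring) ring_center_iff:
  "z \<in> ring_center R \<longleftrightarrow> z \<in> carrier R \<and> (\<forall>r \<in> carrier R. r \<otimes> z = z \<otimes> r)"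
  by (auto simp: ring_center_def Cent_def ring_centralizer_def)

lemma (in ring) subring_ring_center: "subring (ring_center R) R"
  unfolding ring_center_def Cent_def
  by (rule subring_Inter) (auto intro: ring_centralizer_subring)

lemma (in ring) center_subset_centralizer:
  "r \<in> carrier R \<Longrightarrow> ring_center R \<subseteq> ring_centralizer R r"
  by (auto simp: ring_center_def Cent_def)

lemma (in ring) self_in_centralizer: "r \<in> carrier R \<Longrightarrow> r \<in> ring_centralizer R r"
  by (simp add: ring_centralizer_def)

lemma ring_centralizer_sym:
  "\<lbrakk>r \<in> carrier R; s \<in> ring_centralizer R r\<rbrakk> \<Longrightarrow> r \<in> ring_centralizer R s"
  by (simp add: ring_centralizer_def)

lemma (in ring) centralizer_eq_carrier_iff:
  assumes "r \<in> carrier R"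
  shows "ring_centralizer R r = carrier R \<longleftrightarrow> r \<in> ring_center R"
proof -
  have "ring_centralizer R r = carrier R \<longleftrightarrow> (\<forall>s \<in> carrier R. r \<otimes> s = s \<otimes> r)"
    unfolding ring_centralizer_def by blast
  also have "\<dots> \<longleftrightarrow> r \<in> ring_center R"
    unfolding ring_center_iff using assms by metis
  finally show ?thesis .
qed

lemma (in ring) cring_iff_center: "cring R \<longleftrightarrow> ring_center R = carrier R"
proof
  assume "cring R"
  then interpret cring R .
  show "ring_center R = carrier R"
    by (auto simp: ring_center_iff m_comm)
next
  assume "ring_center R = carrier R"
  then have "comm_monoid R"
    using ring_center_iff by (intro monoid_comm_monoidI) auto
  then show "cring R"
    by (simp add: cring_def ring_axioms)
qed

text \<open>
  The heights satisfy \<open>0 < h Z < h C(r) < 3\<close> for noncentral \<open>r\<close>, so \<open>h Z = 1\<close> and \<open>h C(r) = 2\<close>.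
  For noncentral \<open>s \<in> C(r)\<close>, a proper inclusion \<open>C(r) \<inter> C(s) \<subset> C(r)\<close> would put the height of
  the intersection strictly between \<open>1\<close> and \<open>2\<close>, and the same holds with \<open>r\<close> and \<open>s\<close> exchanged.
\<close>

lemma (in ring) centralizers_of_order_p_cubed:
  fixes p :: nat
  assumes p: "Factorial_Ring.prime p" and nc: "\<not> cring R" and ord: "order R = p ^ 3"
  shows card_center: "card (ring_center R) = p"
    and card_centralizer:
      "r \<in> carrier R - ring_center R \<Longrightarrow> card (ring_centralizer R r) = p ^ 2"
    and centralizer_eqI:
      "\<lbrakk>r \<in> carrier R - ring_center R; s \<in> ring_centralizer R r - ring_center R\<rbrakk>
        \<Longrightarrow> ring_centralizer R s = ring_centralizer R r"
proof -
  let ?Z = "ring_center R" and ?C = "ring_centralizer R"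
  have "order (add_monoid R) = p ^ 3"
    using ord by (simp add: order_def)
  then obtain h where
    card: "\<And>H. subgroup H (add_monoid R) \<Longrightarrow> card H = p ^ h H" and
    mono: "\<And>H K. \<lbrakk>subgroup H (add_monoid R); subgroup K (add_monoid R); H \<subset> K\<rbrakk> \<Longrightarrow> h H < h K"
    using add.obtain_subgroup_height[OF p] by metis
  have subZ: "subgroup ?Z (add_monoid R)"
    using subring_ring_center by (rule subring.axioms)
  have subC: "subgroup (?C r) (add_monoid R)" if "r \<in> carrier R" for r
    using ring_centralizer_subring[OF that] by (rule subring.axioms)
  have subR: "subgroup (carrier R) (add_monoid R)"
    using add.subgroup_self by simp
  have hR: "h (carrier R) = 3"
    using card[OF subR] ord prime_gt_1_nat[OF p] by (simp add: order_def)
  have Z_C: "?Z \<subset> ?C r" if "r \<in> carrier R - ?Z" for r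
    using that center_subset_centralizer self_in_centralizer by blast
  have C_R: "?C r \<subset> carrier R" if "r \<in> carrier R - ?Z" for r
    using that centralizer_eq_carrier_iff by (auto simp: ring_centralizer_def)
  have "\<one> \<noteq> \<zero>"
  proof
    assume "\<one> = \<zero>"
    then have "order R = 1"
      using one_zeroD by (simp add: order_def)
    then show False
      using ord prime_gt_1_nat[OF p] by simp
  qed
  have h_Z: "0 < h ?Z"
  proof (rule ccontr)
    assume "\<not> 0 < h ?Z"
    then obtain x where "?Z = {x}"
      using card[OF subZ] by (auto simp: card_1_singleton_iff)
    moreover have "\<zero> \<in> ?Z" "\<one> \<in> ?Z"
      by (auto simp: ring_center_iff)
    ultimately show False
      using \<open>\<one> \<noteq> \<zero>\<close> by auto
  qed
  have heights: "h ?Z = 1" "h (?C r) = 2" if "r \<in> carrier R - ?Z" for r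
  proof -
    have "h ?Z < h (?C r)" "h (?C r) < h (carrier R)"
      using that mono subZ subC subR Z_C C_R by auto
    then show "h ?Z = 1" "h (?C r) = 2"
      using h_Z hR by auto
  qed
  obtain r0 where "r0 \<in> carrier R - ?Z"
    using nc cring_iff_center ring_center_iff by blast
  then show "card ?Z = p"
    using heights card[OF subZ] by simp
  show "card (?C r) = p ^ 2" if "r \<in> carrier R - ?Z" for r
    using that heights card subC by auto
  have C_sub: "?C x \<subseteq> ?C y"
    if "x \<in> carrier R - ?Z" "y \<in> carrier R - ?Z" "x \<in> ?C y" for x y
  proof (rule ccontr)
    assume "\<not> ?C x \<subseteq> ?C y"
    then have upper: "?C x \<inter> ?C y \<subset> ?C x"
      by auto
    have lower: "?Z \<subset> ?C x \<inter> ?C y"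
      using that center_subset_centralizer self_in_centralizer by blast
    have "subgroup (?C x \<inter> ?C y) (add_monoid R)"
      using that subC by (intro add.subgroups_Inter_pair) auto
    then have "h ?Z < h (?C x \<inter> ?C y)" "h (?C x \<inter> ?C y) < h (?C x)"
      using that mono upper lower subZ subC by auto
    then show False
      using heights that(1) by simp
  qed
  show "?C s = ?C r" if r: "r \<in> carrier R - ?Z" and s: "s \<in> ?C r - ?Z" for r s
  proof
    have s': "s \<in> carrier R - ?Z"
      using s by (auto simp: ring_centralizer_def)
    show "?C s \<subseteq> ?C r"
      using C_sub[OF s' r] s by auto
    show "?C r \<subseteq> ?C s"
      using C_sub[OF r s'] ring_centralizer_sym[of r R s] r s by simp
  qed
qed

theorem theorem2p10:
  fixes R :: "('a, 'b) ring_scheme" and p :: nat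
  assumes "Factorial_Ring.prime p"
    and "ring R"
    and "\<not> cring R"
    and "order R = p ^ 3"
  shows "card (Cent R) = p + 2"
proof -
  interpret ring R by fact
  note p_cubed = assms(1,3,4)
  let ?Z = "ring_center R" and ?C = "ring_centralizer R"
  define N where "N = carrier R - ?Z"
  define P where "P = ?C ` N"
  have p1: "1 < p"
    using assms(1) by (rule prime_gt_1_nat)
  then have fin: "finite (carrier R)"
    using assms(4) order_gt_0_iff_finite by fastforce
  have N_self: "r \<in> ?C r" and Z_sub: "?Z \<subseteq> ?C r" if "r \<in> N" for r
    using that self_in_centralizer center_subset_centralizer by (auto simp: N_def)
  have finZ: "finite ?Z"
    using fin by (rule rev_finite_subset) (auto simp: ring_center_iff)
  have cardN: "card N = p ^ 3 - p"
    unfolding N_def using card_center[OF p_cubed] assms(4) finZ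
    by (subst card_Diff_subset) (auto simp: ring_center_iff order_def)
  have Cent: "Cent R = insert (carrier R) P"
  proof -
    have "Cent R = ?C ` ?Z \<union> ?C ` N"
      by (auto simp: Cent_def N_def ring_center_iff)
    moreover have "?C ` ?Z = {carrier R}"
    proof -
      have "?C z = carrier R" if "z \<in> ?Z" for z
        using that centralizer_eq_carrier_iff ring_center_iff by blast
      moreover have "\<zero>\<^bsub>R\<^esub> \<in> ?Z"
        by (simp add: ring_center_iff)
      ultimately show ?thesis by auto
    qed
    ultimately show ?thesis by (simp add: P_def)
  qed
  have finP: "finite P"
    using fin by (simp add: P_def N_def)
  have notin: "carrier R \<notin> P"
    using centralizer_eq_carrier_iff by (auto simp: P_def N_def)
  have same: "?C r = ?C x" if "r \<in> N" "x \<in> ?C r - ?Z" for r x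
    using centralizer_eqI[OF p_cubed] that by (auto simp: N_def)
  \<comment> \<open>Distinct proper centralizers meet exactly in the centre, so removing it makes them disjoint.\<close>
  define Q where "Q = (\<lambda>A. A - ?Z) ` P"
  have cardQ: "card Q = card P"
    unfolding Q_def
  proof (rule card_image, rule inj_onI)
    fix A B assume "A \<in> P" "B \<in> P" and eq: "A - ?Z = B - ?Z"
    then have "?Z \<subseteq> A" "?Z \<subseteq> B"
      using Z_sub by (auto simp: P_def)
    then show "A = B"
      using eq by blast
  qed
  have UQ: "\<Union> Q = N"
    using N_self by (auto simp: Q_def P_def N_def ring_centralizer_def)
  have "(p ^ 2 - p) * card Q = card (\<Union> Q)"
  proof (rule card_partition)
    show "finite Q" "finite (\<Union> Q)"
      using finP fin UQ by (auto simp: Q_def N_def)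
    show "card A = p ^ 2 - p" if "A \<in> Q" for A
      using that card_centralizer[OF p_cubed] card_center[OF p_cubed] Z_sub finZ
      by (auto simp: Q_def P_def N_def card_Diff_subset)
    show "A \<inter> B = {}" if "A \<in> Q" "B \<in> Q" "A \<noteq> B" for A B
    proof (rule ccontr)
      assume "A \<inter> B \<noteq> {}"
      then obtain x where x: "x \<in> A" "x \<in> B" by blast
      from that obtain r s where rs: "r \<in> N" "A = ?C r - ?Z" "s \<in> N" "B = ?C s - ?Z"
        by (auto simp: Q_def P_def)
      with x have "?C r = ?C x" "?C s = ?C x"
        using same by blast+
      with rs \<open>A \<noteq> B\<close> show False by simp
    qed
  qed
  also have "\<dots> = (p ^ 2 - p) * (p + 1)"
    unfolding UQ cardN
    by (simp add: power2_eq_square power3_eq_cube algebra_simps diff_mult_distrib)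
  finally have "(p ^ 2 - p) * card Q = (p ^ 2 - p) * (p + 1)" .
  moreover have "0 < p ^ 2 - p"
    using p1 by (simp add: power2_eq_square)
  ultimately have "card Q = p + 1"
    by (simp only: nat_mult_eq_cancel1)
  then show ?thesis
    using Cent notin finP cardQ by simp
qed

end
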